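(* Suppose $f:\mathbb{R}^d\to\mathbb{R}$ is a $C^2$ function with $\nabla f$ Lipschitz continuous with constant $L_f$, and $g:\mathbb{R}^d\to\mathbb{R}\cup\{+\infty\}$ is proper, lower semicontinuous and $\rho$-weakly convex. Then the map $(x,\gamma)\mapsto Y^{\rm FB}_{f,g}(x,\gamma)$ is locally Lipschitz continuous (jointly in $(x,\gamma)$) at any $(\bar x,\bar\gamma)\in\mathrm{int}(\mathrm{dom}(g))\times(0,\rho^{-1})$; that is, it is Lipschitz continuous on some neighbourhood of $(\bar x,\bar\gamma)$.
   Context: A function $g$ is $\rho$-weakly convex ($\rho\ge0$) if $g+\frac{\rho}{2}\|\cdot\|^2$ is convex. $\mathrm{dom}(g)=\{x:g(x)<+\infty\}$ and $\mathrm{int}$ denotes interior. $\mathrm{prox}_{\gamma g}(x):=\mathrm{argmin}_{y\in\mathbb{R}^d}\{g(y)+\frac1{2\gamma}\|y-x\|^2\}$, which is single-valued for $\gamma\in(0,\rho^{-1})$ (with $0^{-1}=+\infty$). The forward-backward map is $Y^{\rm FB}_{f,g}(x,\gamma):=\mathrm{prox}_{\gamma g}(x-\gamma\nabla f(x))$. *)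

theory Defs
  imports "HOL-Analysis.Analysis"
begin

(* Extended-valued functions R^d -> R \<union> {+\<infinity>} are functions into ereal; properness
   excludes the value -\<infinity>. *)

definition edom :: "('a \<Rightarrow> ereal) \<Rightarrow> 'a set" where
  "edom g = {x. g x < \<infinity>}"

definition proper :: "('a \<Rightarrow> ereal) \<Rightarrow> bool" where
  "proper g \<longleftrightarrow> edom g \<noteq> {} \<and> (\<forall>x. g x \<noteq> -\<infinity>)"

definition lower_semicontinuous :: "('a::topological_space \<Rightarrow> ereal) \<Rightarrow> bool" where
  "lower_semicontinuous g \<longleftrightarrow> (\<forall>x. g x \<le> Liminf (at x) g)"

(* The endpoints u = 0 and v = 0 are harmless, since 0 * \<infinity> = 0 in ereal. *)
definition econvex :: "('a::real_vector \<Rightarrow> ereal) \<Rightarrow> bool" where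
  "econvex h \<longleftrightarrow> (\<forall>x y. \<forall>u\<ge>0. \<forall>v\<ge>0. u + v = 1 \<longrightarrow>
      h (u *\<^sub>R x + v *\<^sub>R y) \<le> ereal u * h x + ereal v * h y)"

definition weakly_convex :: "real \<Rightarrow> ('a::real_normed_vector \<Rightarrow> ereal) \<Rightarrow> bool" where
  "weakly_convex \<rho> g \<longleftrightarrow> \<rho> \<ge> 0 \<and> econvex (\<lambda>x. g x + ereal (\<rho> / 2 * (norm x)\<^sup>2))"

(* C^2 in the sense of Frechet derivatives; continuity of f and of its first derivative
   follows from their differentiability. *)
definition C2 :: "('a::real_normed_vector \<Rightarrow> real) \<Rightarrow> bool" where
  "C2 f \<longleftrightarrow> (\<exists>(f' :: 'a \<Rightarrow> 'a \<Rightarrow>\<^sub>L real) (f'' :: 'a \<Rightarrow> 'a \<Rightarrow>\<^sub>L ('a \<Rightarrow>\<^sub>L real)).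
      (\<forall>x. (f has_derivative blinfun_apply (f' x)) (at x)) \<and>
      (\<forall>x. (f' has_derivative blinfun_apply (f'' x)) (at x)) \<and>
      continuous_on UNIV f'')"

definition gradient :: "('a::real_inner \<Rightarrow> real) \<Rightarrow> 'a \<Rightarrow> 'a" where
  "gradient f x = (THE D. GDERIV f x :> D)"

(* The proximal operator as the set of all minimizers. *)
definition prox :: "real \<Rightarrow> ('a::real_normed_vector \<Rightarrow> ereal) \<Rightarrow> 'a \<Rightarrow> 'a set" where
  "prox \<gamma> g x =
     {y. is_arg_min (\<lambda>z. g z + ereal (1 / (2 * \<gamma>) * (norm (z - x))\<^sup>2)) (\<lambda>_. True) y}"

(* the_elem picks the unique element of prox, which is a singleton for proper, lower
   semicontinuous, \<rho>-weakly convex g and 0 < \<gamma> < 1/\<rho>; elsewhere the value may be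
   arbitrary. *)
definition Y_FB ::
    "('a::real_inner \<Rightarrow> real) \<Rightarrow> ('a \<Rightarrow> ereal) \<Rightarrow> 'a \<Rightarrow> real \<Rightarrow> 'a" where
  "Y_FB f g x \<gamma> = the_elem (prox \<gamma> g (x - \<gamma> *\<^sub>R gradient f x))"

definition locally_lipschitz_at ::
    "('a::metric_space \<Rightarrow> 'b::metric_space) \<Rightarrow> 'a \<Rightarrow> bool" where
  "locally_lipschitz_at F p \<longleftrightarrow> (\<exists>U L. open U \<and> p \<in> U \<and> L-lipschitz_on U F)"

end

theory Submission
  imports Defs
begin

text \<open>
  If \<open>y\<^sub>i\<close> is the proximal point of \<open>u\<^sub>i\<close> with step \<open>\<gamma>\<^sub>i\<close>, then \<open>v\<^sub>i = (u\<^sub>i - y\<^sub>i) / \<gamma>\<^sub>i\<close> is a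
  \<open>\<rho>\<close>-proximal subgradient of \<open>g\<close> at \<open>y\<^sub>i\<close>, so \<open>(v\<^sub>1 - v\<^sub>2) \<bullet> (y\<^sub>1 - y\<^sub>2) \<ge> - \<rho> \<bar>y\<^sub>1 - y\<^sub>2\<bar>\<^sup>2\<close>.
  Solving for \<open>y\<^sub>1 - y\<^sub>2\<close> gives
  \<open>(1/\<gamma>\<^sub>1 - \<rho>) \<bar>y\<^sub>1 - y\<^sub>2\<bar> \<le> \<bar>u\<^sub>1 - u\<^sub>2\<bar>/\<gamma>\<^sub>1 + \<bar>1/\<gamma>\<^sub>1 - 1/\<gamma>\<^sub>2\<bar> \<bar>u\<^sub>2 - y\<^sub>2\<bar>\<close>.
  With a fixed second point this bounds proximal points locally, and then it is the
  Lipschitz estimate itself.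
\<close>

section \<open>Weak convexity and proximal points in real arithmetic\<close>

text \<open>Measures exactly how strongly convex the squared norm is. It yields both the defect
  allowed by weak convexity and the gain from the quadratic term of the proximal problem.\<close>

lemma norm_convex_combination_sq:
  fixes x y :: "'a::real_inner"
  assumes "u + v = 1"
  shows "(norm (u *\<^sub>R x + v *\<^sub>R y))\<^sup>2 = u * (norm x)\<^sup>2 + v * (norm y)\<^sup>2 - u * v * (norm (x - y))\<^sup>2"
proof -
  have v: "v = 1 - u" using assms by simp
  show ?thesis
    unfolding v power2_norm_eq_inner
    by (simp add: inner_add_left inner_add_right inner_diff_left inner_diff_right inner_commute
        algebra_simps)
qed

lemma proper_edom_real:
  assumes "proper g" "x \<in> edom g"
  shows "g x = ereal (real_of_ereal (g x))"
  using assms by (cases "g x") (auto simp: proper_def edom_def)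

text \<open>Moving the terms \<open>\<rho> / 2 * (norm _)\<^sup>2\<close> to one side of the
  convexity inequality leaves only the defect proportional to \<open>u * v\<close>. A finite
  right-hand side also forces the intermediate point into the domain.\<close>

lemma weakly_convex_real:
  fixes g :: "'a::real_inner \<Rightarrow> ereal"
  assumes "proper g" "weakly_convex \<rho> g" "x \<in> edom g" "y \<in> edom g" "u \<ge> 0" "v \<ge> 0" "u + v = 1"
  shows "u *\<^sub>R x + v *\<^sub>R y \<in> edom g"
    and "real_of_ereal (g (u *\<^sub>R x + v *\<^sub>R y)) \<le>
      u * real_of_ereal (g x) + v * real_of_ereal (g y) + \<rho> / 2 * (u * v * (norm (x - y))\<^sup>2)"
proof -
  define w where "w = u *\<^sub>R x + v *\<^sub>R y"
  obtain a where a: "g x = ereal a" using proper_edom_real[OF assms(1,3)] ..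
  obtain b where b: "g y = ereal b" using proper_edom_real[OF assms(1,4)] ..
  have "g w + ereal (\<rho> / 2 * (norm w)\<^sup>2) \<le>
      ereal u * (g x + ereal (\<rho> / 2 * (norm x)\<^sup>2)) + ereal v * (g y + ereal (\<rho> / 2 * (norm y)\<^sup>2))"
    using assms unfolding weakly_convex_def econvex_def w_def by blast
  then have *: "g w + ereal (\<rho> / 2 * (norm w)\<^sup>2) \<le>
      ereal (u * (a + \<rho> / 2 * (norm x)\<^sup>2) + v * (b + \<rho> / 2 * (norm y)\<^sup>2))"
    by (simp add: a b)
  then have w: "w \<in> edom g" by (cases "g w") (auto simp: edom_def)
  then show "u *\<^sub>R x + v *\<^sub>R y \<in> edom g" by (simp add: w_def)
  obtain c where c: "g w = ereal c" using proper_edom_real[OF assms(1) w] ..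
  have "c + \<rho> / 2 * (norm w)\<^sup>2 \<le> u * (a + \<rho> / 2 * (norm x)\<^sup>2) + v * (b + \<rho> / 2 * (norm y)\<^sup>2)"
    using * by (simp add: c)
  moreover have "(norm w)\<^sup>2 = u * (norm x)\<^sup>2 + v * (norm y)\<^sup>2 - u * v * (norm (x - y))\<^sup>2"
    unfolding w_def using assms(7) by (rule norm_convex_combination_sq)
  ultimately have "c \<le> u * a + v * b + \<rho> / 2 * (u * v * (norm (x - y))\<^sup>2)"
    by (simp add: algebra_simps)
  then show "real_of_ereal (g (u *\<^sub>R x + v *\<^sub>R y)) \<le>
      u * real_of_ereal (g x) + v * real_of_ereal (g y) + \<rho> / 2 * (u * v * (norm (x - y))\<^sup>2)"
    using a b c by (simp add: w_def)
qed

text \<open>Properness supplies a competitor with finite value, so a minimizer lies in the domain.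
  Competitors outside the domain have value \<open>\<infinity>\<close> and impose no condition, so
  everything else is an inequality between reals.\<close>

lemma prox_iff:
  assumes "proper g"
  shows "y \<in> prox \<gamma> g u \<longleftrightarrow> y \<in> edom g \<and> (\<forall>z \<in> edom g.
    real_of_ereal (g y) + 1 / (2 * \<gamma>) * (norm (y - u))\<^sup>2 \<le>
    real_of_ereal (g z) + 1 / (2 * \<gamma>) * (norm (z - u))\<^sup>2)" (is "_ \<longleftrightarrow> ?R")
proof
  have prox: "y \<in> prox \<gamma> g u \<longleftrightarrow> (\<forall>z. g y + ereal (1 / (2 * \<gamma>) * (norm (y - u))\<^sup>2) \<le>
      g z + ereal (1 / (2 * \<gamma>) * (norm (z - u))\<^sup>2))"
    by (auto simp: prox_def is_arg_min_def not_less)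
  {
    assume y: "y \<in> prox \<gamma> g u"
    obtain z where z: "z \<in> edom g" using assms by (auto simp: proper_def)
    then have "g y + ereal (1 / (2 * \<gamma>) * (norm (y - u))\<^sup>2) < \<infinity>"
      using y unfolding prox by (auto simp: edom_def intro: le_less_trans)
    then have "y \<in> edom g" by (cases "g y") (auto simp: edom_def)
    then show ?R
      using y proper_edom_real[OF assms] unfolding prox by (metis ereal_less_eq(3) plus_ereal.simps(1))
  next
    assume R: ?R
    show "y \<in> prox \<gamma> g u"
      unfolding prox
    proof
      fix z
      show "g y + ereal (1 / (2 * \<gamma>) * (norm (y - u))\<^sup>2) \<le>
        g z + ereal (1 / (2 * \<gamma>) * (norm (z - u))\<^sup>2)"
      proof (cases "z \<in> edom g")
        case True
        then show ?thesis
          using R proper_edom_real[OF assms] by (metis ereal_less_eq(3) plus_ereal.simps(1))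
      next
        case False
        then show ?thesis by (simp add: edom_def)
      qed
    qed
  }
qed

section \<open>The subgradient inequality and its consequence for two proximal points\<close>

text \<open>First-order optimality: compare \<open>y\<close> with the point
  \<open>(1 - t) *\<^sub>R y + t *\<^sub>R z\<close>, divide by \<open>t\<close>, and let
  \<open>t\<close> fall to 0.\<close>

lemma prox_subgradient:
  fixes g :: "'a::real_inner \<Rightarrow> ereal"
  assumes g: "proper g" "weakly_convex \<rho> g" and "\<gamma> > 0"
    and y: "y \<in> prox \<gamma> g u" and z: "z \<in> edom g"
  shows "real_of_ereal (g y) + (u - y) \<bullet> (z - y) / \<gamma> - \<rho> / 2 * (norm (z - y))\<^sup>2 \<le> real_of_ereal (g z)"
proof -
  define G where "G = (\<lambda>x. real_of_ereal (g x))"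
  define d where "d = (norm (z - y))\<^sup>2"
  define s where "s = (u - y) \<bullet> (z - y)"
  have yd: "y \<in> edom g" and ymin: "\<And>w. w \<in> edom g \<Longrightarrow>
    G y + 1 / (2 * \<gamma>) * (norm (y - u))\<^sup>2 \<le> G w + 1 / (2 * \<gamma>) * (norm (w - u))\<^sup>2"
    using y unfolding prox_iff[OF g(1)] G_def by auto
  have step: "0 \<le> G z - G y + \<rho> / 2 * (1 - t) * d - s / \<gamma> + t / (2 * \<gamma>) * d"
    if t: "0 < t" "t < 1" for t
  proof -
    define w where "w = (1 - t) *\<^sub>R y + t *\<^sub>R z"
    have w: "w \<in> edom g" "G w \<le> (1 - t) * G y + t * G z + \<rho> / 2 * ((1 - t) * t * d)"
      using weakly_convex_real[OF g yd z, of "1 - t" t] t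
      by (auto simp: w_def G_def d_def norm_minus_commute)
    have "(norm (w - u))\<^sup>2 = (norm (y - u))\<^sup>2 - 2 * t * s + t\<^sup>2 * d"
      unfolding w_def d_def s_def power2_norm_eq_inner
      by (simp add: inner_diff_left inner_diff_right inner_add_left inner_add_right inner_commute
          algebra_simps power2_eq_square)
    then have "1 / (2 * \<gamma>) * (norm (w - u))\<^sup>2 =
        1 / (2 * \<gamma>) * (norm (y - u))\<^sup>2 + 1 / (2 * \<gamma>) * (t\<^sup>2 * d - 2 * t * s)"
      by (simp only: distrib_left[symmetric]) simp
    then have "0 \<le> (1 - t) * G y + t * G z + \<rho> / 2 * ((1 - t) * t * d) - G y
        + 1 / (2 * \<gamma>) * (t\<^sup>2 * d - 2 * t * s)"
      using ymin[OF w(1)] w(2) by linarith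
    also have "\<dots> = t * (G z - G y + \<rho> / 2 * (1 - t) * d - s / \<gamma> + t / (2 * \<gamma>) * d)"
      using \<open>\<gamma> > 0\<close> by (simp add: field_simps power2_eq_square)
    finally show ?thesis using t by (simp add: zero_le_mult_iff)
  qed
  \<comment> \<open>This is the limit of \<open>step\<close> as \<open>t\<close> tends to 0 from the
    right. The zeros are kept visible so that the limit has the shape of the expression in
    \<open>t\<close>.\<close>
  have "0 \<le> G z - G y + \<rho> / 2 * (1 - 0) * d - s / \<gamma> + 0 / (2 * \<gamma>) * d"
  proof (rule tendsto_lowerbound)
    show "((\<lambda>t. G z - G y + \<rho> / 2 * (1 - t) * d - s / \<gamma> + t / (2 * \<gamma>) * d) \<longlongrightarrow>
        G z - G y + \<rho> / 2 * (1 - 0) * d - s / \<gamma> + 0 / (2 * \<gamma>) * d) (at_right 0)"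
      using \<open>\<gamma> > 0\<close> by (intro tendsto_intros) auto
    show "\<forall>\<^sub>F t in at_right 0. 0 \<le> G z - G y + \<rho> / 2 * (1 - t) * d - s / \<gamma> + t / (2 * \<gamma>) * d"
      using step by (auto simp: eventually_at_right_field intro!: exI[of _ 1])
  qed simp
  then show ?thesis by (simp add: G_def d_def s_def)
qed

text \<open>Each subgradient inequality is tested at the other proximal point. In the sum the values
  of \<open>g\<close> cancel, and after Cauchy-Schwarz a common factor \<open>norm (y1 - y2)\<close>
  can be divided out. Equal data make the right side vanish, which also gives uniqueness.\<close>

lemma prox_estimate:
  fixes g :: "'a::real_inner \<Rightarrow> ereal"
  assumes g: "proper g" "weakly_convex \<rho> g" and "\<gamma>1 > 0" "\<gamma>2 > 0"
    and y1: "y1 \<in> prox \<gamma>1 g u1" and y2: "y2 \<in> prox \<gamma>2 g u2"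
  shows "(1 / \<gamma>1 - \<rho>) * norm (y1 - y2) \<le>
    norm (u1 - u2) / \<gamma>1 + \<bar>1 / \<gamma>1 - 1 / \<gamma>2\<bar> * norm (u2 - y2)"
proof (cases "y1 = y2")
  case False
  let ?d = "y1 - y2"
  let ?k = "1 / \<gamma>1 - 1 / \<gamma>2"
  have "y1 \<in> edom g" "y2 \<in> edom g" using y1 y2 prox_iff[OF g(1)] by auto
  then have "(u1 - y1) \<bullet> (y2 - y1) / \<gamma>1 + (u2 - y2) \<bullet> (y1 - y2) / \<gamma>2 \<le> \<rho> * (norm ?d)\<^sup>2"
    using prox_subgradient[OF g \<open>\<gamma>1 > 0\<close> y1, of y2] prox_subgradient[OF g \<open>\<gamma>2 > 0\<close> y2, of y1]
    by (simp add: norm_minus_commute)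
  moreover have "(u1 - y1) \<bullet> (y2 - y1) / \<gamma>1 + (u2 - y2) \<bullet> (y1 - y2) / \<gamma>2 =
      (norm ?d)\<^sup>2 / \<gamma>1 - ((u1 - u2) \<bullet> ?d / \<gamma>1 + ?k * ((u2 - y2) \<bullet> ?d))"
    unfolding power2_norm_eq_inner
    by (simp add: inner_diff_left inner_diff_right inner_commute field_simps add_divide_distrib
        diff_divide_distrib)
  moreover have "(u1 - u2) \<bullet> ?d / \<gamma>1 \<le> norm (u1 - u2) * norm ?d / \<gamma>1"
    using \<open>\<gamma>1 > 0\<close> by (intro divide_right_mono norm_cauchy_schwarz) auto
  moreover have "?k * ((u2 - y2) \<bullet> ?d) \<le> \<bar>?k\<bar> * (norm (u2 - y2) * norm ?d)"
    using mult_left_mono[OF Cauchy_Schwarz_ineq2[of "u2 - y2" ?d], of "\<bar>?k\<bar>"]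
      abs_ge_self[of "?k * ((u2 - y2) \<bullet> ?d)"]
    unfolding abs_mult by linarith
  ultimately have "(1 / \<gamma>1 - \<rho>) * (norm ?d)\<^sup>2 \<le>
      norm (u1 - u2) * norm ?d / \<gamma>1 + \<bar>?k\<bar> * (norm (u2 - y2) * norm ?d)"
    by (simp add: left_diff_distrib)
  then have "((1 / \<gamma>1 - \<rho>) * norm ?d) * norm ?d \<le>
      (norm (u1 - u2) / \<gamma>1 + \<bar>?k\<bar> * norm (u2 - y2)) * norm ?d"
    by (simp add: power2_eq_square algebra_simps)
  then show ?thesis by (rule mult_right_le_imp_le) (use False in simp)
qed (use assms in simp)

section \<open>Existence and uniqueness of proximal points\<close>

lemma lower_semicontinuous_le_lim:
  fixes g :: "'a::topological_space \<Rightarrow> ereal"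
  assumes "lower_semicontinuous g" and X: "X \<longlonglongrightarrow> x" and l: "(\<lambda>n. g (X n)) \<longlonglongrightarrow> l"
  shows "g x \<le> l"
proof (rule ccontr)
  assume "\<not> g x \<le> l"
  then obtain c where c: "l < c" "c < g x" using dense[of l "g x"] by (auto simp: not_le)
  then have "c < Liminf (at x) g"
    using assms(1) unfolding lower_semicontinuous_def by (metis less_le_trans)
  then have "\<forall>\<^sub>F z in at x. c < g z" using le_Liminf_iff[of "Liminf (at x) g" "at x" g] by auto
  \<comment> \<open>The filter \<open>at x\<close> omits \<open>x\<close>, but the sequence may
    visit it; \<open>c < g x\<close> closes this gap.\<close>
  then have "\<forall>\<^sub>F z in nhds x. c < g z"
    unfolding eventually_at_filter by (rule eventually_mono) (use c in auto)
  then have "\<forall>\<^sub>F n in sequentially. c < g (X n)"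
    using X by (rule eventually_compose_filterlim)
  moreover have "\<forall>\<^sub>F n in sequentially. g (X n) < c" using l c(1) by (rule order_tendstoD)
  ultimately have "\<forall>\<^sub>F n in sequentially. False" by eventually_elim auto
  then show False by simp
qed

text \<open>Direct method: a minimizing sequence in \<open>K\<close> has a convergent subsequence,
  and lower semicontinuity bounds the value at its limit by the infimum.\<close>

lemma lower_semicontinuous_attains_inf:
  fixes g :: "'a::metric_space \<Rightarrow> ereal"
  assumes "lower_semicontinuous g" "continuous_on UNIV q" "compact K" "K \<noteq> {}"
  shows "\<exists>y\<in>K. \<forall>z\<in>K. g y + ereal (q y) \<le> g z + ereal (q z)"
proof -
  let ?h = "\<lambda>z. g z + ereal (q z)"
  obtain a where a: "\<And>n. a n \<in> ?h ` K" "a \<longlonglongrightarrow> Inf (?h ` K)"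
    using Inf_as_limit[of "?h ` K"] assms(4) by blast
  then have "\<forall>n. \<exists>x\<in>K. a n = ?h x" by blast
  then obtain X where X: "\<And>n. X n \<in> K" "\<And>n. a n = ?h (X n)" by metis
  obtain y r where y: "y \<in> K" "strict_mono r" "(X \<circ> r) \<longlonglongrightarrow> y"
    using \<open>compact K\<close> X(1) unfolding compact_def by metis
  let ?m = "Inf (?h ` K)"
  have h: "(\<lambda>n. ?h (X (r n))) \<longlonglongrightarrow> ?m"
    using LIMSEQ_subseq_LIMSEQ[OF a(2) y(2)] by (simp add: X(2) comp_def)
  have q: "(\<lambda>n. ereal (- q (X (r n)))) \<longlonglongrightarrow> ereal (- q y)"
    using continuous_on_tendsto_compose[OF assms(2) y(3)]
    by (auto simp: comp_def intro!: tendsto_intros)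
  \<comment> \<open>The infimum may be infinite, but the subtracted term has a finite limit, so the
    sum of the limits is well defined. This isolates \<open>g\<close> along the subsequence.\<close>
  have "(\<lambda>n. ?h (X (r n)) + ereal (- q (X (r n)))) \<longlonglongrightarrow> ?m + ereal (- q y)"
    by (rule tendsto_add_ereal_general[OF _ h q]) simp
  moreover have eq: "b + ereal c + ereal (- c) = b" for b c by (cases b) auto
  ultimately have "(\<lambda>n. g (X (r n))) \<longlonglongrightarrow> ?m + ereal (- q y)" by simp
  then have "g y \<le> ?m + ereal (- q y)"
    using lower_semicontinuous_le_lim[OF assms(1) y(3)] by (simp add: comp_def)
  then have "?h y \<le> ?m + ereal (- q y) + ereal (q y)" by (rule add_right_mono)
  also have "\<dots> = ?m" using eq[of ?m "- q y"] by simp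
  finally show ?thesis using y(1) by (meson INF_lower order_trans)
qed

text \<open>The objective \<open>P\<close> is strongly convex with modulus
  \<open>1 / \<gamma> - \<rho>\<close>, so outside a large enough ball about \<open>z0\<close> it is
  at least \<open>P z0\<close>. A minimizer on that compact ball is then global.\<close>

lemma prox_nonempty:
  fixes g :: "'a::euclidean_space \<Rightarrow> ereal"
  assumes g: "proper g" "weakly_convex \<rho> g" and lsc: "lower_semicontinuous g"
    and \<gamma>: "\<gamma> > 0" "\<rho> < 1 / \<gamma>"
  shows "prox \<gamma> g u \<noteq> {}"
proof -
  define q where "q = (\<lambda>z. 1 / (2 * \<gamma>) * (norm (z - u))\<^sup>2)"
  define P where "P = (\<lambda>z. real_of_ereal (g z) + q z)"
  define \<mu> where "\<mu> = 1 / \<gamma> - \<rho>"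
  have \<mu>: "\<mu> > 0" using \<gamma> by (simp add: \<mu>_def)
  have q: "continuous_on UNIV q" unfolding q_def by (intro continuous_intros)
  obtain z0 where z0: "z0 \<in> edom g" using g by (auto simp: proper_def)
  have min: "\<exists>y \<in> edom g. y \<in> cball z0 R \<and> (\<forall>z \<in> edom g \<inter> cball z0 R. P y \<le> P z)"
    if R: "R \<ge> 0" for R
  proof -
    obtain y where y: "y \<in> cball z0 R" "\<And>z. z \<in> cball z0 R \<Longrightarrow> g y + ereal (q y) \<le> g z + ereal (q z)"
      using lower_semicontinuous_attains_inf[OF lsc q, of "cball z0 R"] R by auto
    have "g y + ereal (q y) < \<infinity>"
      using y(2)[of z0] R z0 by (auto simp: edom_def intro: le_less_trans)
    then have ye: "y \<in> edom g" by (cases "g y") (auto simp: edom_def)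
    moreover have "P y \<le> P z" if "z \<in> edom g \<inter> cball z0 R" for z
      using y(2)[of z] that ye proper_edom_real[OF g(1)] unfolding P_def
      by (metis IntD1 IntD2 ereal_less_eq(3) plus_ereal.simps(1))
    ultimately show ?thesis using y(1) by blast
  qed
  \<comment> \<open>\<open>P y1\<close> serves as a lower bound for \<open>P\<close> on the unit
    ball about \<open>z0\<close>.\<close>
  obtain y1 where y1: "\<And>z. z \<in> edom g \<inter> cball z0 1 \<Longrightarrow> P y1 \<le> P z"
    using min[OF zero_le_one] by blast
  \<comment> \<open>Chosen so that \<open>\<mu> / 2 * (R - 1)\<close> exceeds
    \<open>P z0 - P y1\<close>, the amount that the strong convexity gain must cover in
    \<open>far\<close>.\<close>
  define R where "R = 2 + 2 * \<bar>P z0 - P y1\<bar> / \<mu>"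
  have R: "R > 1" using \<mu> by (simp add: R_def add_pos_nonneg)
  obtain y where y: "y \<in> edom g" "\<And>z. z \<in> edom g \<inter> cball z0 R \<Longrightarrow> P y \<le> P z"
    using min[of R] R by (meson less_imp_le order_trans zero_le_one)
  \<comment> \<open>Strong convexity along the segment from \<open>z0\<close> to \<open>z\<close>, through the point at distance 1 from
    \<open>z0\<close>, where \<open>P\<close> is at least \<open>P y1\<close>.\<close>
  have far: "P z0 \<le> P z" if z: "z \<in> edom g" "z \<notin> cball z0 R" for z
  proof -
    define t where "t = norm (z - z0)"
    have t: "t > R" using z by (simp add: t_def dist_norm norm_minus_commute)
    define v where "v = 1 / t"
    have v: "0 < v" "v < 1" "v * t = 1" using t R by (auto simp: v_def)
    define w where "w = (1 - v) *\<^sub>R z0 + v *\<^sub>R z"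
    have w: "w \<in> edom g" "real_of_ereal (g w) \<le> (1 - v) * real_of_ereal (g z0) +
        v * real_of_ereal (g z) + \<rho> / 2 * ((1 - v) * v * t\<^sup>2)"
      using weakly_convex_real[OF g z0 z(1), of "1 - v" v] v
      by (auto simp: w_def t_def norm_minus_commute)
    have "w - z0 = v *\<^sub>R (z - z0)" by (simp add: w_def algebra_simps)
    then have "norm (w - z0) = 1" using v by (simp add: t_def)
    then have "P y1 \<le> P w" using y1 w(1) by (simp add: dist_norm norm_minus_commute)
    moreover have "w - u = (1 - v) *\<^sub>R (z0 - u) + v *\<^sub>R (z - u)"
      by (simp add: w_def algebra_simps)
    then have "(norm (w - u))\<^sup>2 =
        (1 - v) * (norm (z0 - u))\<^sup>2 + v * (norm (z - u))\<^sup>2 - (1 - v) * v * t\<^sup>2"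
      using norm_convex_combination_sq[of "1 - v" v "z0 - u" "z - u"]
      by (simp add: t_def norm_minus_commute)
    then have "q w = 1 / (2 * \<gamma>) *
        ((1 - v) * (norm (z0 - u))\<^sup>2 + v * (norm (z - u))\<^sup>2 - (1 - v) * v * t\<^sup>2)"
      by (simp only: q_def)
    then have "q w = (1 - v) * q z0 + v * q z - 1 / (2 * \<gamma>) * ((1 - v) * v * t\<^sup>2)"
      by (simp add: q_def algebra_simps add_divide_distrib diff_divide_distrib)
    ultimately have "P y1 \<le> (1 - v) * P z0 + v * P z - \<mu> / 2 * ((1 - v) * v * t\<^sup>2)"
      using w(2) by (simp add: P_def \<mu>_def algebra_simps diff_divide_distrib)
    \<comment> \<open>With \<open>v = 1 / t\<close> the gain grows linearly in the distance
      \<open>t\<close>.\<close>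
    moreover have "(1 - v) * v * t\<^sup>2 = t - 1"
      using v(3) by (simp add: power2_eq_square algebra_simps)
    moreover have "\<mu> / 2 * (t - 1) \<ge> P z0 - P y1"
    proof -
      have "\<mu> / 2 * (R - 1) = \<mu> / 2 + \<bar>P z0 - P y1\<bar>"
        using \<mu> by (simp add: R_def field_simps)
      then have "P z0 - P y1 \<le> \<mu> / 2 * (R - 1)" using \<mu> by linarith
      also have "\<dots> \<le> \<mu> / 2 * (t - 1)" using t \<mu> by simp
      finally show ?thesis .
    qed
    moreover have "(1 - v) * P z0 = P z0 - v * P z0" by (simp add: algebra_simps)
    ultimately have "v * P z0 \<le> v * P z" by (simp only:)
    then show ?thesis using v by simp
  qed
  have "P y \<le> P z" if "z \<in> edom g" for z
    using y(2)[of z0] y(2)[of z] far[of z] that z0 R by (cases "z \<in> cball z0 R") auto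
  then have "y \<in> prox \<gamma> g u" using y(1) by (simp add: prox_iff[OF g(1)] P_def q_def)
  then show ?thesis by blast
qed

text \<open>Justifies reading \<open>the_elem\<close> as the proximal point; uniqueness is
  \<open>prox_estimate\<close> with equal centres and steps.\<close>

lemma prox_eq_singleton:
  fixes g :: "'a::euclidean_space \<Rightarrow> ereal"
  assumes g: "proper g" "weakly_convex \<rho> g" and "lower_semicontinuous g"
    and \<gamma>: "\<gamma> > 0" "\<rho> < 1 / \<gamma>"
  shows "prox \<gamma> g u = {the_elem (prox \<gamma> g u)}"
proof -
  obtain y where y: "y \<in> prox \<gamma> g u" using prox_nonempty[OF assms] by blast
  have "z = y" if "z \<in> prox \<gamma> g u" for z
    using prox_estimate[OF g \<gamma>(1) \<gamma>(1) that y] \<gamma>(2) by (simp add: mult_le_0_iff)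
  then have "prox \<gamma> g u = {y}" using y by blast
  then show ?thesis by simp
qed

section \<open>Joint Lipschitz bounds on bounded sets\<close>

text \<open>The upper bound \<open>b\<close> keeps \<open>1 / \<gamma> - \<rho>\<close> at least
  \<open>c > 0\<close>, and the lower bound \<open>a\<close> controls reciprocals of steps. What
  remains is a uniform bound on the residuals \<open>u - p u \<gamma>\<close>.\<close>

lemma prox_lipschitz_on_bounded:
  fixes g :: "'a::euclidean_space \<Rightarrow> ereal"
  assumes g: "proper g" "weakly_convex \<rho> g" and lsc: "lower_semicontinuous g"
    and ab: "0 < a" "a \<le> b" "\<rho> < 1 / b" and S: "bounded S"
  shows "\<exists>L. L-lipschitz_on (S \<times> {a..b}) (\<lambda>(u, \<gamma>). the_elem (prox \<gamma> g u))"
proof -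
  define p where "p = (\<lambda>u \<gamma>. the_elem (prox \<gamma> g u))"
  define c where "c = 1 / b - \<rho>"
  have c: "c > 0" using ab by (simp add: c_def)
  have inv_le: "1 / \<gamma> \<ge> 1 / b" "1 / \<gamma> \<le> 1 / a" "0 < \<gamma>" if "\<gamma> \<in> {a..b}" for \<gamma>
    using that ab by (auto intro: divide_left_mono)
  have p: "p u \<gamma> \<in> prox \<gamma> g u" if "\<gamma> \<in> {a..b}" for u \<gamma>
    using prox_eq_singleton[OF g lsc, of \<gamma> u] inv_le[OF that] ab(3) by (auto simp: p_def)
  have est: "c * norm (p u1 \<gamma>1 - p u2 \<gamma>2) \<le>
      norm (u1 - u2) / a + \<bar>\<gamma>1 - \<gamma>2\<bar> / a\<^sup>2 * norm (u2 - p u2 \<gamma>2)"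
    if \<gamma>: "\<gamma>1 \<in> {a..b}" "\<gamma>2 \<in> {a..b}" for u1 u2 \<gamma>1 \<gamma>2
  proof -
    have "c * norm (p u1 \<gamma>1 - p u2 \<gamma>2) \<le> (1 / \<gamma>1 - \<rho>) * norm (p u1 \<gamma>1 - p u2 \<gamma>2)"
      using inv_le[OF \<gamma>(1)] by (intro mult_right_mono) (auto simp: c_def)
    also have "\<dots> \<le> norm (u1 - u2) / \<gamma>1 + \<bar>1 / \<gamma>1 - 1 / \<gamma>2\<bar> * norm (u2 - p u2 \<gamma>2)"
      using prox_estimate[OF g _ _ p[OF \<gamma>(1)] p[OF \<gamma>(2)]] inv_le \<gamma> by blast
    also have "\<dots> \<le> norm (u1 - u2) / a + \<bar>\<gamma>1 - \<gamma>2\<bar> / a\<^sup>2 * norm (u2 - p u2 \<gamma>2)"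
    proof (intro add_mono mult_right_mono)
      show "norm (u1 - u2) / \<gamma>1 \<le> norm (u1 - u2) / a"
        using \<gamma> ab by (intro divide_left_mono) auto
      have "\<bar>1 / \<gamma>1 - 1 / \<gamma>2\<bar> = \<bar>\<gamma>1 - \<gamma>2\<bar> / (\<gamma>1 * \<gamma>2)"
        using inv_le(3)[OF \<gamma>(1)] inv_le(3)[OF \<gamma>(2)]
        by (simp add: diff_frac_eq abs_mult abs_minus_commute)
      also have "\<dots> \<le> \<bar>\<gamma>1 - \<gamma>2\<bar> / a\<^sup>2"
        using \<gamma> ab by (intro divide_left_mono) (auto simp: power2_eq_square intro: mult_mono)
      finally show "\<bar>1 / \<gamma>1 - 1 / \<gamma>2\<bar> \<le> \<bar>\<gamma>1 - \<gamma>2\<bar> / a\<^sup>2" .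
    qed auto
    finally show ?thesis .
  qed
  obtain N where N: "N > 0" "\<And>u. u \<in> S \<Longrightarrow> norm u \<le> N" using S unfolding bounded_pos by blast
  \<comment> \<open>Comes from \<open>est\<close> with the fixed reference pair
    \<open>(0, a)\<close> as second point, using \<open>norm u \<le> N\<close> and
    \<open>\<bar>\<gamma> - a\<bar> \<le> b - a\<close>, followed by the triangle
    inequality.\<close>
  define B where "B = N + (N / a + (b - a) / a\<^sup>2 * norm (p 0 a)) / c + norm (p 0 a)"
  have B: "norm (u - p u \<gamma>) \<le> B" if "u \<in> S" "\<gamma> \<in> {a..b}" for u \<gamma>
  proof -
    have "c * norm (p u \<gamma> - p 0 a) \<le> norm u / a + \<bar>\<gamma> - a\<bar> / a\<^sup>2 * norm (p 0 a)"
      using est[OF that(2), of a u 0] ab by simp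
    also have "\<dots> \<le> N / a + (b - a) / a\<^sup>2 * norm (p 0 a)"
      using that N ab by (intro add_mono mult_right_mono divide_right_mono) auto
    finally have "norm (p u \<gamma> - p 0 a) \<le> (N / a + (b - a) / a\<^sup>2 * norm (p 0 a)) / c"
      using c by (simp add: pos_le_divide_eq mult.commute)
    moreover have "norm (u - p u \<gamma>) \<le> norm u + norm (p u \<gamma> - p 0 a) + norm (p 0 a)"
      by norm
    ultimately show ?thesis using N(2)[OF that(1)] by (simp add: B_def)
  qed
  have "B \<ge> 0" using N(1) ab c by (simp add: B_def)
  have "((1 / a + B / a\<^sup>2) / c)-lipschitz_on (S \<times> {a..b}) (\<lambda>(u, \<gamma>). p u \<gamma>)"
  proof (rule lipschitz_onI)
    fix x y assume "x \<in> S \<times> {a..b}" "y \<in> S \<times> {a..b}"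
    then obtain u1 \<gamma>1 u2 \<gamma>2 where xy: "x = (u1, \<gamma>1)" "y = (u2, \<gamma>2)"
      "u2 \<in> S" "\<gamma>1 \<in> {a..b}" "\<gamma>2 \<in> {a..b}" by auto
    have d: "norm (u1 - u2) \<le> dist x y" "\<bar>\<gamma>1 - \<gamma>2\<bar> \<le> dist x y"
      using dist_fst_le[of x y] dist_snd_le[of x y] by (auto simp: xy dist_norm)
    have "c * norm (p u1 \<gamma>1 - p u2 \<gamma>2) \<le> dist x y / a + dist x y / a\<^sup>2 * B"
      by (rule order_trans[OF est[OF xy(4,5)]], intro add_mono mult_mono divide_right_mono)
        (use d B[OF xy(3,5)] ab in auto)
    then show "dist (case x of (u, \<gamma>) \<Rightarrow> p u \<gamma>) (case y of (u, \<gamma>) \<Rightarrow> p u \<gamma>) \<le>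
        (1 / a + B / a\<^sup>2) / c * dist x y"
      using c by (simp add: xy dist_norm pos_le_divide_eq algebra_simps)
  qed (use ab c \<open>B \<ge> 0\<close> in simp)
  then show ?thesis by (auto simp: p_def)
qed

text \<open>The product \<open>\<gamma> *\<^sub>R F x\<close> is not globally Lipschitz in general,
  but on bounded sets both factors are bounded and Lipschitz.\<close>

lemma forward_step_lipschitz_on_bounded:
  fixes F :: "'a::real_normed_vector \<Rightarrow> 'a"
  assumes F: "L-lipschitz_on UNIV F" and "bounded S" "bounded T"
  shows "\<exists>M. M-lipschitz_on (S \<times> T) (\<lambda>(x, \<gamma>). x - \<gamma> *\<^sub>R F x)"
proof -
  have L: "L \<ge> 0" and LF: "norm (F x - F y) \<le> L * norm (x - y)" for x y
    using F by (auto simp: lipschitz_on_def dist_norm)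
  obtain B where B: "B > 0" "\<And>x. x \<in> S \<Longrightarrow> norm x \<le> B" using assms(2) unfolding bounded_pos by auto
  define N where "N = norm (F 0) + L * B"
  have N: "N \<ge> 0" "\<And>x. x \<in> S \<Longrightarrow> norm (F x) \<le> N"
  proof -
    show "N \<ge> 0" using L B(1) by (simp add: N_def)
    fix x assume "x \<in> S"
    then have "norm (F x - F 0) \<le> L * B"
      using LF[of x 0] mult_left_mono[OF B(2) L] by fastforce
    then show "norm (F x) \<le> N" using norm_triangle_sub[of "F x" "F 0"] by (simp add: N_def)
  qed
  obtain b where b: "b > 0" "\<And>\<gamma>. \<gamma> \<in> T \<Longrightarrow> \<bar>\<gamma>\<bar> \<le> b" using assms(3) unfolding bounded_pos by auto
  have "(1 + b * L + N)-lipschitz_on (S \<times> T) (\<lambda>(x, \<gamma>). x - \<gamma> *\<^sub>R F x)"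
  proof (rule lipschitz_onI)
    fix x y assume "x \<in> S \<times> T" "y \<in> S \<times> T"
    then obtain x1 \<gamma>1 x2 \<gamma>2 where xy: "x = (x1, \<gamma>1)" "y = (x2, \<gamma>2)"
      "x2 \<in> S" "\<gamma>1 \<in> T" by auto
    have d: "norm (x1 - x2) \<le> dist x y" "\<bar>\<gamma>1 - \<gamma>2\<bar> \<le> dist x y"
      using dist_fst_le[of x y] dist_snd_le[of x y] by (auto simp: xy dist_norm)
    have "norm (F x1 - F x2) \<le> L * dist x y"
      using LF[of x1 x2] d(1) L by (meson mult_left_mono order_trans)
    then have "\<bar>\<gamma>1\<bar> * norm (F x1 - F x2) \<le> b * (L * dist x y)"
      using b xy(4) by (intro mult_mono) auto
    moreover have "\<bar>\<gamma>1 - \<gamma>2\<bar> * norm (F x2) \<le> dist x y * N"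
      using d N xy(3) by (intro mult_mono) auto
    moreover have "(x1 - \<gamma>1 *\<^sub>R F x1) - (x2 - \<gamma>2 *\<^sub>R F x2) =
        (x1 - x2) - \<gamma>1 *\<^sub>R (F x1 - F x2) - (\<gamma>1 - \<gamma>2) *\<^sub>R F x2"
      by (simp add: algebra_simps)
    then have "norm ((x1 - \<gamma>1 *\<^sub>R F x1) - (x2 - \<gamma>2 *\<^sub>R F x2)) \<le>
        norm (x1 - x2) + \<bar>\<gamma>1\<bar> * norm (F x1 - F x2) + \<bar>\<gamma>1 - \<gamma>2\<bar> * norm (F x2)"
      by (metis (no_types, lifting) add_right_mono norm_scaleR norm_triangle_ineq4 order_trans)
    ultimately show "dist (case x of (x, \<gamma>) \<Rightarrow> x - \<gamma> *\<^sub>R F x) (case y of (x, \<gamma>) \<Rightarrow> x - \<gamma> *\<^sub>R F x) \<le>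
        (1 + b * L + N) * dist x y"
      using d(1) by (simp add: xy dist_norm algebra_simps)
  qed (use L N b in simp)
  then show ?thesis by blast
qed

section \<open>Composition of the forward step with the proximal map near the given point\<close>

theorem proposition6:
  fixes f :: "real ^ 'd \<Rightarrow> real" and g :: "real ^ 'd \<Rightarrow> ereal"
    and L\<^sub>f \<rho> \<gamma>bar :: real and xbar :: "real ^ 'd"
  assumes "C2 f"
    and "L\<^sub>f-lipschitz_on UNIV (gradient f)"
    and "proper g" and "lower_semicontinuous g" and "weakly_convex \<rho> g"
    and "xbar \<in> interior (edom g)"
    and "0 < \<gamma>bar" and "ereal \<gamma>bar < inverse (ereal \<rho>)"
  shows "locally_lipschitz_at (\<lambda>(x, \<gamma>). Y_FB f g x \<gamma>) (xbar, \<gamma>bar)"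
proof -
  have "\<rho> \<ge> 0" using assms(5) by (simp add: weakly_convex_def)
  then have \<rho>: "\<rho> * \<gamma>bar < 1"
    using assms(7,8) by (cases "\<rho> = 0") (auto simp: field_simps)
  \<comment> \<open>For \<open>\<rho> > 0\<close>, \<open>b\<close> is the midpoint of
    \<open>\<gamma>bar\<close> and \<open>1 / \<rho>\<close>. The case \<open>\<rho> = 0\<close> is
    separate because real division gives \<open>1 / 0 = 0\<close>, which would put the midpoint
    below \<open>\<gamma>bar\<close>.\<close>
  define a b where "a = \<gamma>bar / 2" and "b = (if \<rho> = 0 then 2 * \<gamma>bar else (\<gamma>bar + 1 / \<rho>) / 2)"
  have ab: "0 < a" "a < \<gamma>bar" "\<gamma>bar < b" "\<rho> < 1 / b"
    using assms(7) \<rho> \<open>\<rho> \<ge> 0\<close> by (auto simp: a_def b_def field_simps add_pos_pos)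
  \<comment> \<open>Carrying the step size along makes \<open>Y_FB\<close> the composition of the
    proximal map, as a function of centre and step, with \<open>h\<close>.\<close>
  define h where "h = (\<lambda>(x, \<gamma>). (x - \<gamma> *\<^sub>R gradient f x, \<gamma> :: real))"
  let ?V = "ball xbar 1 \<times> {a..b}"
  obtain M where "M-lipschitz_on ?V (\<lambda>(x, \<gamma>). x - \<gamma> *\<^sub>R gradient f x)"
    using forward_step_lipschitz_on_bounded[OF assms(2) bounded_ball bounded_closed_interval] by blast
  then have "(sqrt (M\<^sup>2 + 1\<^sup>2))-lipschitz_on ?V
      (\<lambda>z. ((\<lambda>(x, \<gamma>). x - \<gamma> *\<^sub>R gradient f x) z, snd z))"
    by (rule lipschitz_on_Pair) (auto simp: lipschitz_on_def dist_snd_le)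
  then have h: "(sqrt (M\<^sup>2 + 1\<^sup>2))-lipschitz_on ?V h" by (simp add: h_def case_prod_beta)
  \<comment> \<open>The Lipschitz bound for the proximal map needs a bounded set of centres; the
    forward step sends the bounded box to one.\<close>
  have "bounded (h ` ?V)"
    by (intro bounded_uniformly_continuous_image lipschitz_on_uniformly_continuous[OF h]
        bounded_Times bounded_ball bounded_closed_interval)
  then have "bounded (fst ` h ` ?V)" by (rule bounded_fst)
  then obtain L where
    L: "L-lipschitz_on (fst ` h ` ?V \<times> {a..b}) (\<lambda>(u, \<gamma>). the_elem (prox \<gamma> g u))"
    using prox_lipschitz_on_bounded[OF assms(3,5,4), of a b] ab by force
  have "h ` ?V \<subseteq> fst ` h ` ?V \<times> {a..b}"
    by (force simp: h_def)
  then have "(L * sqrt (M\<^sup>2 + 1\<^sup>2))-lipschitz_on ?V ((\<lambda>(u, \<gamma>). the_elem (prox \<gamma> g u)) \<circ> h)"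
    using lipschitz_on_compose[OF h] lipschitz_on_subset[OF L] by blast
  then have "(L * sqrt (M\<^sup>2 + 1\<^sup>2))-lipschitz_on (ball xbar 1 \<times> {a<..<b}) (\<lambda>(x, \<gamma>). Y_FB f g x \<gamma>)"
    by (rule lipschitz_on_subset[THEN lipschitz_on_transform])
      (auto simp: h_def Y_FB_def)
  moreover have "open (ball xbar 1 \<times> {a<..<b})" by (intro open_Times) auto
  moreover have "(xbar, \<gamma>bar) \<in> ball xbar 1 \<times> {a<..<b}" using ab by simp
  ultimately show ?thesis unfolding locally_lipschitz_at_def by blast
qed

end
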